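(* Let $P$ be a dcpo that is quasiexact and moderately meet continuous, and suppose that the weak way-below relation $\ll_w$ on $P$ is weakly increasing. Then $P$ is a domain (i.e. a continuous dcpo).
   Context: Let $P$ be a poset. For $A\subseteq P$, $\uparrow A=\{x\in P: y\le x \text{ for some } y\in A\}$ and $\downarrow A=\{x\in P: x\le y\text{ for some }y\in A\}$; write $\uparrow x,\downarrow x$ for $A=\{x\}$. Directed sets are nonempty. A dcpo is a poset in which every directed subset has a supremum. Way-below: $x\ll y$ iff for every directed $D$ whose supremum exists, $y\le\bigvee D$ implies $x\le d$ for some $d\in D$. $P$ is continuous if for every $x$ the set $\{y: y\ll x\}$ is directed with supremum $x$. Weak way-below: for $x,y\in P$, $x\ll_w y$ iff for every directed $D\subseteq P$ with $\bigvee D=y$ (supremum exists and equals $y$), $D\cap\uparrow x\ne\varnothing$. For $G\subseteq P$ and $y\in P$, $G\ll_w y$ iff for every directed $D\subseteq P$ with $\bigvee D=y$, $D\cap\uparrow G\neq\varnothing$. The relation $\ll_w$ is weakly increasing if for all $x,y,z,u\in P$, $x\ll_w y\le z\ll_w u$ implies $x\ll_w z$. $\mathrm{fin}_w(x)=\{F\subseteq P: F\text{ finite}, F\ll_w x\}$. A nonempty family $\mathcal F$ of subsets of $P$ is directed if for all $F_1,F_2\in\mathcal F$ there is $F_3\in\mathcal F$ with $F_3\subseteq\uparrow F_1\cap\uparrow F_2$. $P$ is quasiexact if for every $x\in P$ the family $\mathrm{fin}_w(x)$ is directed and $\bigcap\{\uparrow F: F\in\mathrm{fin}_w(x)\}=\uparrow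 x$. For $F\subseteq P$ put $U_F=\{a\in P: F\ll_w a\}$. $P$ admits the wf topology if $\{U_F: F\subseteq P\text{ finite}\}$ is a base of a topology on $P$; this topology is denoted $\tau_{wf}(P)$ (every quasiexact poset admits it). A poset $P$ admitting the wf topology is moderately meet continuous if for every $x\in P$ and every directed $D\subseteq P$ (with existing supremum), $x\le\bigvee D$ implies $x\in\mathrm{cl}_{\tau_{wf}}(\downarrow D\cap\downarrow x)$, the closure taken in $\tau_{wf}(P)$. *)

theory Defs
  imports "HOL-Library.Lub_Glb" "HOL-Analysis.Abstract_Topology"
begin

text \<open>
  A poset is a set \<open>P\<close> in a type of class \<^class>\<open>order\<close>, with the induced order; the empty
  poset is allowed. All notions are relative to \<open>P\<close>. That \<open>s\<close> is the supremum of \<open>D\<close> in \<open>P\<close>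
  is the library's \<open>isLub P D s\<close>, which includes \<open>s \<in> P\<close>. The predicates below
  presuppose that their point arguments lie in \<open>P\<close> and their set arguments are subsets of \<open>P\<close>.
\<close>

definition up_set :: "'a::order set \<Rightarrow> 'a set \<Rightarrow> 'a set" where
  "up_set P A = {x \<in> P. \<exists>y\<in>A. y \<le> x}"

definition down_set :: "'a::order set \<Rightarrow> 'a set \<Rightarrow> 'a set" where
  "down_set P A = {x \<in> P. \<exists>y\<in>A. x \<le> y}"

definition directed_subset :: "'a::order set \<Rightarrow> 'a set \<Rightarrow> bool" where
  "directed_subset P D \<longleftrightarrow>
     D \<subseteq> P \<and> D \<noteq> {} \<and> (\<forall>x\<in>D. \<forall>y\<in>D. \<exists>z\<in>D. x \<le> z \<and> y \<le> z)"

definition dcpo :: "'a::order set \<Rightarrow> bool" where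
  "dcpo P \<longleftrightarrow> (\<forall>D. directed_subset P D \<longrightarrow> (\<exists>s. isLub P D s))"

definition way_below :: "'a::order set \<Rightarrow> 'a \<Rightarrow> 'a \<Rightarrow> bool" where
  "way_below P x y \<longleftrightarrow>
     (\<forall>D s. directed_subset P D \<and> isLub P D s \<and> y \<le> s \<longrightarrow> (\<exists>d\<in>D. x \<le> d))"

definition continuous_poset :: "'a::order set \<Rightarrow> bool" where
  "continuous_poset P \<longleftrightarrow>
     (\<forall>x\<in>P. directed_subset P {y \<in> P. way_below P y x} \<and> isLub P {y \<in> P. way_below P y x} x)"

definition continuous_domain :: "'a::order set \<Rightarrow> bool" where
  "continuous_domain P \<longleftrightarrow> dcpo P \<and> continuous_poset P"

definition weak_way_below_set :: "'a::order set \<Rightarrow> 'a set \<Rightarrow> 'a \<Rightarrow> bool" where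
  "weak_way_below_set P G y \<longleftrightarrow>
     (\<forall>D. directed_subset P D \<and> isLub P D y \<longrightarrow> D \<inter> up_set P G \<noteq> {})"

definition weak_way_below :: "'a::order set \<Rightarrow> 'a \<Rightarrow> 'a \<Rightarrow> bool" where
  "weak_way_below P x y \<longleftrightarrow>
     (\<forall>D. directed_subset P D \<and> isLub P D y \<longrightarrow> D \<inter> up_set P {x} \<noteq> {})"

definition weakly_increasing :: "'a::order set \<Rightarrow> bool" where
  "weakly_increasing P \<longleftrightarrow>
     (\<forall>x\<in>P. \<forall>y\<in>P. \<forall>z\<in>P. \<forall>u\<in>P.
        weak_way_below P x y \<and> y \<le> z \<and> weak_way_below P z u \<longrightarrow> weak_way_below P x z)"

definition fin_w :: "'a::order set \<Rightarrow> 'a \<Rightarrow> 'a set set" where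
  "fin_w P x = {F. F \<subseteq> P \<and> finite F \<and> weak_way_below_set P F x}"

definition directed_family :: "'a::order set \<Rightarrow> 'a set set \<Rightarrow> bool" where
  "directed_family P \<F> \<longleftrightarrow>
     \<F> \<noteq> {} \<and> (\<forall>F1\<in>\<F>. \<forall>F2\<in>\<F>. \<exists>F3\<in>\<F>. F3 \<subseteq> up_set P F1 \<inter> up_set P F2)"

definition quasiexact :: "'a::order set \<Rightarrow> bool" where
  "quasiexact P \<longleftrightarrow>
     (\<forall>x\<in>P. directed_family P (fin_w P x) \<and> \<Inter> (up_set P ` fin_w P x) = up_set P {x})"

definition wf_basic :: "'a::order set \<Rightarrow> 'a set \<Rightarrow> 'a set" where
  "wf_basic P F = {a \<in> P. weak_way_below_set P F a}"

definition wf_base :: "'a::order set \<Rightarrow> 'a set set" where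
  "wf_base P = {wf_basic P F |F. F \<subseteq> P \<and> finite F}"

definition admits_wf_topology :: "'a::order set \<Rightarrow> bool" where
  "admits_wf_topology P \<longleftrightarrow>
     (\<exists>T. topspace T = P \<and> openin T = arbitrary union_of (\<lambda>U. U \<in> wf_base P))"

text \<open>Meaningful only if \<open>admits_wf_topology P\<close>; \<^const>\<open>topology\<close> is unspecified otherwise.\<close>

definition wf_topology :: "'a::order set \<Rightarrow> 'a topology" where
  "wf_topology P = topology (arbitrary union_of (\<lambda>U. U \<in> wf_base P))"

definition moderately_meet_continuous :: "'a::order set \<Rightarrow> bool" where
  "moderately_meet_continuous P \<longleftrightarrow>
     admits_wf_topology P \<and>
     (\<forall>x\<in>P. \<forall>D s. directed_subset P D \<and> isLub P D s \<and> x \<le> s \<longrightarrow>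
        x \<in> wf_topology P closure_of (down_set P D \<inter> down_set P {x}))"

end

theory Submission
  imports Defs
begin

text \<open>
  If \<open>F\<close> is finite and \<open>F \<lless>\<^sub>w x\<close>, then some \<open>y \<in> F\<close> is way below \<open>x\<close>. Otherwise every \<open>y \<in> F\<close> has a
  directed set \<open>D\<^sub>y\<close> with \<open>x \<le> \<Squnion>D\<^sub>y\<close> that misses \<open>\<up>y\<close>. Treating the elements of \<open>F\<close> one after the
  other, moderate meet continuity lets one descend from \<open>x\<close> inside the open set \<open>U\<^sub>F\<close>, each step
  entering one more \<open>\<down>D\<^sub>y\<close>. The final point lies in \<open>U\<^sub>F \<subseteq> \<up>F\<close> but above no element of \<open>F\<close>, a
  contradiction. Quasiexactness then turns information about finite sets into information about
  points.
\<close>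

lemma isLub_iff:
  "isLub P D s \<longleftrightarrow> s \<in> P \<and> (\<forall>d\<in>D. d \<le> s) \<and> (\<forall>u\<in>P. (\<forall>d\<in>D. d \<le> u) \<longrightarrow> s \<le> u)"
  by (auto simp: isLub_def leastP_def isUb_def setle_def setge_def)

lemma singleton_directed_isLub:
  assumes "x \<in> P"
  shows "directed_subset P {x}" "isLub P {x} x"
  using assms by (simp_all add: directed_subset_def isLub_iff)

text \<open>Admissibility supplies a genuine topology with the prescribed open sets, so
  \<open>topology\<close> does recover it by \<open>openin_inverse\<close>.\<close>

lemma openin_wf_topology_wf_basic:
  assumes "admits_wf_topology P" "F \<subseteq> P" "finite F"
  shows "openin (wf_topology P) (wf_basic P F)"
proof -
  obtain T where T: "openin T = arbitrary union_of (\<lambda>U. U \<in> wf_base P)"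
    using assms(1) unfolding admits_wf_topology_def by blast
  have "wf_topology P = T"
    unfolding wf_topology_def T[symmetric] by (rule openin_inverse)
  moreover have "wf_basic P F \<in> wf_base P"
    using assms(2,3) unfolding wf_base_def by blast
  ultimately show ?thesis
    by (simp add: T arbitrary_union_of_inc)
qed

text \<open>The set \<open>{x}\<close> is directed with supremum \<open>x\<close>, so it must meet
  \<open>up_set P F\<close>.\<close>

lemma weak_way_below_set_imp_up_set:
  assumes "x \<in> P" "weak_way_below_set P F x"
  shows "x \<in> up_set P F"
  using assms(2)[unfolded weak_way_below_set_def, rule_format, of "{x}"]
    singleton_directed_isLub[OF assms(1)]
  by simp

lemma way_below_imp_le:
  assumes "x \<in> P" "way_below P y x"
  shows "y \<le> x"
proof -
  have "\<exists>d\<in>{x}. y \<le> d"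
    using assms singleton_directed_isLub[OF assms(1)] unfolding way_below_def by (meson order_refl)
  then show ?thesis by simp
qed

lemma way_below_imp_weak_way_below_set:
  assumes "way_below P y x"
  shows "weak_way_below_set P {y} x"
  unfolding weak_way_below_set_def
proof (intro allI impI, elim conjE)
  fix D assume D: "directed_subset P D" "isLub P D x"
  then obtain d where "d \<in> D" "y \<le> d"
    using assms unfolding way_below_def by (meson order_refl)
  then show "D \<inter> up_set P {y} \<noteq> {}"
    using D(1) by (auto simp: up_set_def directed_subset_def)
qed

text \<open>\<open>A\<close> is kept apart from \<open>F\<close> so that the induction can enlarge
  \<open>A\<close> while every point of the descent stays in the same open set
  \<open>wf_basic P F\<close>.\<close>

lemma exists_wf_basic_avoiding_not_way_below:
  assumes mmc: "moderately_meet_continuous P" and F: "F \<subseteq> P" "finite F"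
    and x: "x \<in> wf_basic P F"
    and A: "finite A" "\<And>y. y \<in> A \<Longrightarrow> \<not> way_below P y x"
  shows "\<exists>z\<in>wf_basic P F. z \<le> x \<and> (\<forall>y\<in>A. \<not> y \<le> z)"
  using A
proof (induction A rule: finite_induct)
  case empty
  then show ?case using x by auto
next
  case (insert y A)
  obtain z where z: "z \<in> wf_basic P F" "z \<le> x" "\<forall>a\<in>A. \<not> a \<le> z"
    using insert.IH insert.prems by (meson insertI2)
  obtain D s where D: "directed_subset P D" "isLub P D s" "x \<le> s" "\<forall>d\<in>D. \<not> y \<le> d"
    using insert.prems[of y] unfolding way_below_def by (meson insertI1)
  \<comment> \<open>The set \<open>D\<close> was chosen for \<open>x\<close>, but it serves
    \<open>z\<close> as well, since \<open>z \<le> x \<le> s\<close>.\<close>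
  have "z \<in> P" "z \<le> s"
    using z D(3) by (auto simp: wf_basic_def)
  then have "z \<in> wf_topology P closure_of (down_set P D \<inter> down_set P {z})"
    using mmc D(1,2) unfolding moderately_meet_continuous_def by blast
  moreover have "openin (wf_topology P) (wf_basic P F)"
    using mmc F openin_wf_topology_wf_basic unfolding moderately_meet_continuous_def by blast
  ultimately obtain w where w: "w \<in> wf_basic P F" "w \<in> down_set P D" "w \<in> down_set P {z}"
    using z(1) unfolding in_closure_of by blast
  then have "w \<le> z"
    by (simp add: down_set_def)
  have "\<not> y \<le> w"
    using w(2) D(4) order_trans[of y w] unfolding down_set_def by blast
  moreover have "\<forall>a\<in>A. \<not> a \<le> w"
    using z(3) order_trans[OF _ \<open>w \<le> z\<close>] by blast
  ultimately show ?case
    using w(1) order_trans[OF \<open>w \<le> z\<close> z(2)] by blast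
qed

lemma fin_w_contains_way_below:
  assumes "moderately_meet_continuous P" "x \<in> P" "F \<in> fin_w P x"
  shows "\<exists>y\<in>F. way_below P y x"
proof (rule ccontr)
  assume none: "\<not> ?thesis"
  have F: "F \<subseteq> P" "finite F" and x: "x \<in> wf_basic P F"
    using assms(2,3) by (auto simp: fin_w_def wf_basic_def)
  obtain z where "z \<in> wf_basic P F" and z: "\<forall>y\<in>F. \<not> y \<le> z"
    using exists_wf_basic_avoiding_not_way_below[OF assms(1) F x F(2)] none by blast
  then have "z \<in> up_set P F"
    by (auto simp: wf_basic_def intro: weak_way_below_set_imp_up_set)
  then show False
    using z by (auto simp: up_set_def)
qed

lemma moderately_meet_continuous_quasiexact_imp_continuous:
  assumes qe: "quasiexact P" and mmc: "moderately_meet_continuous P"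
  shows "continuous_poset P"
  unfolding continuous_poset_def
proof (intro ballI conjI)
  fix x assume x: "x \<in> P"
  let ?W = "{y \<in> P. way_below P y x}"
  have dir: "directed_family P (fin_w P x)"
    and Inter: "\<Inter> (up_set P ` fin_w P x) = up_set P {x}"
    using qe x unfolding quasiexact_def by blast+
  have meets: "\<exists>y\<in>F. y \<in> ?W" if "F \<in> fin_w P x" for F
    using fin_w_contains_way_below[OF mmc x that] that by (auto simp: fin_w_def)
  show "directed_subset P ?W"
    unfolding directed_subset_def
  proof (intro conjI ballI)
    show "?W \<subseteq> P" by blast
    show "?W \<noteq> {}"
      using dir meets unfolding directed_family_def by blast
    fix a b assume "a \<in> ?W" "b \<in> ?W"
    \<comment> \<open>As singletons, \<open>a\<close> and \<open>b\<close> fall under the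
      directedness of \<open>fin_w P x\<close>; a point of the common refinement that is way below
      \<open>x\<close> bounds both.\<close>
    then have "{a} \<in> fin_w P x" "{b} \<in> fin_w P x"
      by (auto simp: fin_w_def way_below_imp_weak_way_below_set)
    then obtain F where "F \<in> fin_w P x" "F \<subseteq> up_set P {a} \<inter> up_set P {b}"
      using dir unfolding directed_family_def by blast
    then show "\<exists>c\<in>?W. a \<le> c \<and> b \<le> c"
      using meets[of F] unfolding up_set_def by blast
  qed
  have "x \<le> u" if u: "u \<in> P" "\<forall>y\<in>?W. y \<le> u" for u
  proof -
    \<comment> \<open>\<open>F\<close> contains a point way below \<open>x\<close>, and the upper
      bound \<open>u\<close> lies above it.\<close>
    have "u \<in> up_set P F" if "F \<in> fin_w P x" for F
      using meets[OF that] u unfolding up_set_def by blast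
    then have "u \<in> up_set P {x}"
      using Inter by blast
    then show ?thesis by (simp add: up_set_def)
  qed
  then show "isLub P ?W x"
    unfolding isLub_iff using x way_below_imp_le[OF x] by blast
qed

theorem corollary4p13:
  fixes P :: "'a::order set"
  assumes "dcpo P"
    and "quasiexact P"
    and "moderately_meet_continuous P"
    and "weakly_increasing P"
  shows "continuous_domain P"
  using assms moderately_meet_continuous_quasiexact_imp_continuous
  unfolding continuous_domain_def by blast

end
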